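(* Consider Misère Connect $k$ on a board with odd height $h\ge 3$ and odd width $w\ge k\ge 3$. If P1 plays the delayed take-even strategy, then, whatever P2 does, P1 always has a move prescribed by the strategy available, and P2 is eventually forced to connect $k$ (before P1 does). In particular, P1 has a guaranteed win.
   Context: Misère Connect $k$ is played on a grid with $w$ columns and $h$ rows ($w,h$ positive integers). Player 1 (P1, pieces X) and Player 2 (P2, pieces O) alternate turns, P1 first. On each turn the player selects a non-full column and their piece occupies the lowest empty cell of that column; a column is full after $h$ plays. A player connects $k$ when $k$ of their pieces occupy $k$ consecutive cells in a horizontal, vertical, or diagonal (either direction) line. The first player to connect $k$ loses (the other wins) and the game ends. If the board fills with no player having connected $k$, the game is a draw. Here rows are numbered $0,1,\dots,h-1$ from the bottom. The delayed take-even strategy for P1 is: the opening move is (necessarily) in row $0$; afterwards, (1) if the opponent plays in row $0$, follow with a non-losing move in row $0$; (2) if the opponent plays in any other row, play directly on top of the opponent's piece. The "non-losing" moves in row $0$ (including the opening move) are those made according to a fixed strategy for the first player in the one-row game (height $1$, same width $w$) that guarantees that this player never has $k$ consecutive pieces in row $0$. *)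

theory Defs
  imports Main
begin

datatype player = P1 | P2

fun opponent :: "player \<Rightarrow> player" where
  "opponent P1 = P2"
| "opponent P2 = P1"

text \<open>A history of a game is the list of the columns played so far, in chronological order.
  Columns and rows are numbered from 0, rows starting at the bottom.\<close>

type_synonym history = "nat list"

text \<open>The player who makes move number \<open>n\<close>, counting from 0.\<close>

definition mover :: "nat \<Rightarrow> player" where
  "mover n = (if even n then P1 else P2)"

text \<open>The owners of the pieces in column \<open>c\<close>, from bottom to top.\<close>

definition stack :: "history \<Rightarrow> nat \<Rightarrow> player list" where
  "stack ms c = map mover (filter (\<lambda>i. ms ! i = c) [0..<length ms])"

definition col_height :: "history \<Rightarrow> nat \<Rightarrow> nat" where
  "col_height ms c = length (stack ms c)"

definition occupies :: "history \<Rightarrow> player \<Rightarrow> nat \<Rightarrow> nat \<Rightarrow> bool" where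
  "occupies ms p c r \<longleftrightarrow> r < col_height ms c \<and> stack ms c ! r = p"

text \<open>The four alternatives are horizontal, vertical, rising diagonal and falling diagonal lines;
  the last one is traversed from its lower right end.\<close>

definition connects :: "nat \<Rightarrow> player \<Rightarrow> history \<Rightarrow> bool" where
  "connects k p ms \<longleftrightarrow>
     (\<exists>c r. (\<forall>i<k. occupies ms p (c + i) r) \<or>
            (\<forall>i<k. occupies ms p c (r + i)) \<or>
            (\<forall>i<k. occupies ms p (c + i) (r + i)) \<or>
            (\<forall>i<k. occupies ms p (c + (k - 1 - i)) (r + i)))"

text \<open>In what follows the board has \<open>w\<close> columns and \<open>h\<close> rows.\<close>

definition legal :: "nat \<Rightarrow> nat \<Rightarrow> history \<Rightarrow> nat \<Rightarrow> bool" where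
  "legal w h ms c \<longleftrightarrow> c < w \<and> col_height ms c < h"

definition game_over :: "nat \<Rightarrow> nat \<Rightarrow> nat \<Rightarrow> history \<Rightarrow> bool" where
  "game_over w h k ms \<longleftrightarrow>
     connects k P1 ms \<or> connects k P2 ms \<or> (\<forall>c. \<not> legal w h ms c)"

inductive play :: "nat \<Rightarrow> nat \<Rightarrow> nat \<Rightarrow> history \<Rightarrow> bool" for w h k :: nat where
  start: "play w h k []"
| move: "play w h k ms \<Longrightarrow> \<not> game_over w h k ms \<Longrightarrow> legal w h ms c \<Longrightarrow> play w h k (ms @ [c])"

text \<open>As a play stops at the first connection, at most one player connects \<open>k\<close> in it.\<close>

definition wins :: "nat \<Rightarrow> player \<Rightarrow> history \<Rightarrow> bool" where
  "wins k p ms \<longleftrightarrow> connects k (opponent p) ms"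

text \<open>A strategy maps a history to the column to be played next; its values matter only
  where the player is to move and the game is not over.\<close>

type_synonym strategy = "history \<Rightarrow> nat"

definition follows :: "player \<Rightarrow> strategy \<Rightarrow> history \<Rightarrow> bool" where
  "follows p s ms \<longleftrightarrow> (\<forall>i<length ms. mover i = p \<longrightarrow> ms ! i = s (take i ms))"

definition legal_strategy :: "nat \<Rightarrow> nat \<Rightarrow> nat \<Rightarrow> player \<Rightarrow> strategy \<Rightarrow> bool" where
  "legal_strategy w h k p s \<longleftrightarrow>
     (\<forall>ms. play w h k ms \<and> follows p s ms \<and> mover (length ms) = p \<and> \<not> game_over w h k ms
            \<longrightarrow> legal w h ms (s ms))"

definition winning_strategy :: "nat \<Rightarrow> nat \<Rightarrow> nat \<Rightarrow> player \<Rightarrow> strategy \<Rightarrow> bool" where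
  "winning_strategy w h k p s \<longleftrightarrow>
     legal_strategy w h k p s \<and>
     (\<forall>t. legal_strategy w h k (opponent p) t \<longrightarrow>
        (\<exists>ms. play w h k ms \<and> follows p s ms \<and> follows (opponent p) t ms \<and> wins k p ms))"

text \<open>A strategy for the first player in the game of height 1 under which this player never
  connects \<open>k\<close>.\<close>

definition nonlosing_row_strategy :: "nat \<Rightarrow> nat \<Rightarrow> strategy \<Rightarrow> bool" where
  "nonlosing_row_strategy w k \<sigma> \<longleftrightarrow>
     legal_strategy w 1 k P1 \<sigma> \<and>
     (\<forall>ms. play w 1 k ms \<and> follows P1 \<sigma> ms \<longrightarrow> \<not> connects k P1 ms)"

text \<open>The moves of a history that landed in row 0, as a history of the game of height 1.\<close>

definition row0 :: "history \<Rightarrow> history" where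
  "row0 ms = map (\<lambda>i. ms ! i) (filter (\<lambda>i. col_height (take i ms) (ms ! i) = 0) [0..<length ms])"

text \<open>The cell (column, row) in which delayed take-even, based on the one-row strategy \<open>\<sigma>\<close>, asks
  the first player to place the next piece. The number \<open>r\<close> is the row in which
  the last piece landed.\<close>

definition take_even_cell :: "strategy \<Rightarrow> history \<Rightarrow> nat \<times> nat" where
  "take_even_cell \<sigma> ms =
     (if ms = [] then (\<sigma> [], 0)
      else let c = last ms; r = col_height (butlast ms) c
           in if r = 0 then (\<sigma> (row0 ms), 0) else (c, r + 1))"

definition delayed_take_even :: "strategy \<Rightarrow> strategy" where
  "delayed_take_even \<sigma> ms = fst (take_even_cell \<sigma> ms)"

definition available :: "nat \<Rightarrow> nat \<Rightarrow> history \<Rightarrow> nat \<times> nat \<Rightarrow> bool" where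
  "available w h ms cell \<longleftrightarrow> legal w h ms (fst cell) \<and> snd cell = col_height ms (fst cell)"

end

theory Submission
  imports Defs
begin

text \<open>
  Suppose the first player follows delayed take-even. After each of his moves every column is
  empty or has odd height: a piece in row 0 is followed by pairs consisting of a piece of the
  second player and the reply on top of it. Hence above row 0 the board is striped: odd
  rows belong to the second player, even rows to the first (\<open>take_even_invariant\<close>). This has
  three consequences.

  The reply is always available (\<open>take_even_available\<close>). On top of a piece in an odd row there is
  room, because \<open>h\<close> is odd. In row 0 there is room, because the first player opened there and every
  later move of the second player in row 0 was answered there: when the first
  player has to reply in row 0, an even number of its \<open>w\<close> cells are taken, and \<open>w\<close> is odd. The moves
  in row 0, read on their own, alternate between the players, and they form a play of the one-row
  game in which the first player follows the given strategy.

  The first player never connects (\<open>layered_P1_connects\<close>). A line that is not horizontal meets two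
  adjacent rows, and the stripes forbid that both of its cells are his. A line in row 0 is
  excluded by the one-row strategy. Under a line in a higher even row there lies a line of the
  second player, who would have connected before.

  The second player does connect: the board is finite, so otherwise it would fill up, and a full
  row 1 consists of his pieces only and has length \<open>w \<ge> k\<close> (\<open>full_layered_P2_connects\<close>).

  A one-row strategy exists: open in column 0, group the remaining even number of columns into
  adjacent pairs, and answer each move in the same pair. Three consecutive cells contain a
  pair, and the first player owns one cell of each completed pair (\<open>nonlosing_row_strategy_pairing\<close>).\<close>

section \<open>Histories extended by one move\<close>

lemma mover_eq_iff [simp]:
  "mover n = P1 \<longleftrightarrow> even n" "mover n = P2 \<longleftrightarrow> odd n"
  by (auto simp: mover_def)

lemma stack_Nil [simp]: "stack [] c = []"
  by (simp add: stack_def)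

lemma stack_snoc:
  "stack (ms @ [c]) d = stack ms d @ (if d = c then [mover (length ms)] else [])"
proof -
  have "filter (\<lambda>i. (ms @ [c]) ! i = d) [0..<length ms] = filter (\<lambda>i. ms ! i = d) [0..<length ms]"
    by (rule filter_cong) (auto simp: nth_append)
  then show ?thesis by (simp add: stack_def)
qed

lemma col_height_Nil [simp]: "col_height [] c = 0"
  by (simp add: col_height_def)

lemma col_height_snoc:
  "col_height (ms @ [c]) d = col_height ms d + (if d = c then 1 else 0)"
  by (simp add: col_height_def stack_snoc)

lemma occupies_snoc:
  "occupies (ms @ [c]) p d r \<longleftrightarrow>
     occupies ms p d r \<or> (d = c \<and> r = col_height ms c \<and> p = mover (length ms))"
  by (auto simp: occupies_def col_height_snoc stack_snoc nth_append) (auto simp: col_height_def)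

lemma row0_Nil [simp]: "row0 [] = []"
  by (simp add: row0_def)

lemma row0_snoc: "row0 (ms @ [c]) = row0 ms @ (if col_height ms c = 0 then [c] else [])"
proof -
  have "filter (\<lambda>i. col_height (take i (ms @ [c])) ((ms @ [c]) ! i) = 0) [0..<length ms] =
        filter (\<lambda>i. col_height (take i ms) (ms ! i) = 0) [0..<length ms]"
    by (rule filter_cong) (auto simp: nth_append)
  then show ?thesis by (auto simp: row0_def nth_append)
qed

lemma take_even_cell_snoc:
  "take_even_cell \<sigma> (ms @ [c]) =
     (if col_height ms c = 0 then (\<sigma> (row0 (ms @ [c])), 0) else (c, col_height ms c + 1))"
  by (simp add: take_even_cell_def Let_def)

lemma follows_Nil [simp]: "follows p s []"
  by (simp add: follows_def)

lemma follows_snoc: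
  "follows p s (ms @ [c]) \<longleftrightarrow> follows p s ms \<and> (mover (length ms) = p \<longrightarrow> c = s ms)"
  by (auto simp: follows_def less_Suc_eq nth_append)

section \<open>Plays\<close>

lemma play_col_height_le: "play w h k ms \<Longrightarrow> col_height ms c \<le> h"
  by (induction rule: play.induct) (auto simp: col_height_snoc legal_def)

lemma play_length_eq_sum: "play w h k ms \<Longrightarrow> length ms = (\<Sum>c<w. col_height ms c)"
  by (induction rule: play.induct) (auto simp: col_height_snoc legal_def sum.distrib)

lemma play_length_le:
  assumes "play w h k ms"
  shows "length ms \<le> w * h"
proof -
  have "(\<Sum>c<w. col_height ms c) \<le> (\<Sum>c<w. h)"
    using play_col_height_le[OF assms] by (intro sum_mono)
  then show ?thesis using play_length_eq_sum[OF assms] by simp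
qed

text \<open>A play in which both players follow legal strategies can be continued until the game is over, as
  each move is prescribed by one of the two strategies, and a play has at most \<open>w * h\<close> moves.\<close>

lemma ex_complete_play:
  assumes s: "legal_strategy w h k P1 s" and t: "legal_strategy w h k P2 t"
  shows "\<exists>ms. play w h k ms \<and> follows P1 s ms \<and> follows P2 t ms \<and> game_over w h k ms"
proof -
  let ?ok = "\<lambda>ms. play w h k ms \<and> follows P1 s ms \<and> follows P2 t ms"
  have "\<exists>ms. ?ok ms \<and> (game_over w h k ms \<or> length ms = n)" for n
  proof (induction n)
    case 0
    show ?case by (rule exI[of _ "[]"]) (simp add: play.start)
  next
    case (Suc n)
    then obtain ms where ms: "?ok ms" "game_over w h k ms \<or> length ms = n" by blast
    show ?case
    proof (cases "game_over w h k ms")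
      case True
      then show ?thesis using ms by blast
    next
      case False
      define c where "c = (if even n then s ms else t ms)"
      have "legal w h ms c"
        using s t ms False by (auto simp: legal_strategy_def c_def)
      then have "play w h k (ms @ [c])" using ms False by (auto intro: play.move)
      then have "?ok (ms @ [c])" using ms False by (auto simp: follows_snoc c_def)
      then show ?thesis using ms False by (intro exI[of _ "ms @ [c]"]) auto
    qed
  qed
  from this[of "Suc (w * h)"] show ?thesis
    using play_length_le by (metis Suc_n_not_le_n)
qed

text \<open>The only features of a line that the argument uses: a vertical or diagonal line has
  cells in two adjacent rows. Their columns are irrelevant.\<close>

lemma connects_cases:
  assumes "connects k p ms" and "k \<ge> 2"
  obtains (row) c r where "\<And>i. i < k \<Longrightarrow> occupies ms p (c + i) r"
  | (rising) c d r where "occupies ms p c r" "occupies ms p d (Suc r)"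
proof -
  from assms(1) consider
      (a) c r where "\<forall>i<k. occupies ms p (c + i) r"
    | (b) f r where "\<forall>i<k. occupies ms p (f i) (r + i)"
    unfolding connects_def by (elim exE disjE) (blast | metis)+
  then show thesis
  proof cases
    case a
    then show thesis using row by blast
  next
    case b
    then have "occupies ms p (f 0) (r + 0)" "occupies ms p (f 1) (r + 1)"
      using b[rule_format, of 0] b[rule_format, of 1] assms(2) by simp_all
    then show thesis using rising[of "f 0" r "f 1"] by simp
  qed
qed

lemma connects_rowI: "(\<And>i. i < k \<Longrightarrow> occupies ms p (c + i) r) \<Longrightarrow> connects k p ms"
  by (auto simp: connects_def)

lemma connects_mono:
  assumes "connects k p ms" and "\<And>c r. occupies ms p c r \<Longrightarrow> occupies ms' p c r"
  shows "connects k p ms'"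
  using assms unfolding connects_def by meson

lemma connects_snoc_other:
  assumes "connects k p (ms @ [c])" and "mover (length ms) \<noteq> p"
  shows "connects k p ms"
  using assms(1) by (rule connects_mono) (use assms(2) in \<open>auto simp: occupies_snoc\<close>)

section \<open>A non-losing strategy in the game of height 1\<close>

text \<open>The pairs are the columns \<open>2 * i + 1\<close> and \<open>2 * i + 2\<close>. Column 0 has no partner; the
  value \<open>partner 0 = 0\<close> is meaningless, which is why the statements below exclude this column.\<close>

definition partner :: "nat \<Rightarrow> nat" where
  "partner c = (if odd c then c + 1 else c - 1)"

lemma partner_facts:
  assumes "c > 0"
  shows "partner c > 0" "partner (partner c) = c" "partner c \<noteq> c"
    "odd w \<Longrightarrow> partner c < w \<longleftrightarrow> c < w"
proof -
  show "partner c > 0" "partner (partner c) = c" "partner c \<noteq> c"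
    using assms by (auto simp: partner_def elim!: oddE evenE)
  show "partner c < w \<longleftrightarrow> c < w" if "odd w"
    using assms that unfolding partner_def by presburger
qed

definition pairing :: strategy where
  "pairing ms = (if ms = [] then 0 else partner (last ms))"

definition paired :: "history \<Rightarrow> bool" where
  "paired ms \<longleftrightarrow> col_height ms 0 = 1 \<and> (\<forall>c>0. col_height ms c = col_height ms (partner c))"

definition pairs_split :: "history \<Rightarrow> bool" where
  "pairs_split ms \<longleftrightarrow> (\<forall>c>0. \<not> (occupies ms P1 c 0 \<and> occupies ms P1 (partner c) 0))"

text \<open>One round of the pairing strategy. Since column 0 is taken and partners are both empty or both
  taken, the second player's move leaves its partner free for the answer, and the answer completes a
  pair of which the first player owns only one cell.\<close>

lemma pairing_answer:
  assumes "odd w" and "paired ms" and "pairs_split ms" and "odd (length ms)" and "legal w 1 ms c"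
  defines "d \<equiv> partner c"
  shows "legal w 1 (ms @ [c]) d" "pairs_split (ms @ [c])"
    "paired (ms @ [c, d])" "pairs_split (ms @ [c, d])"
proof -
  have c: "c < w" "col_height ms c = 0" using assms(5) by (auto simp: legal_def)
  have p0: "col_height ms 0 = 1" and pr: "x > 0 \<Longrightarrow> col_height ms x = col_height ms (partner x)" for x
    using \<open>paired ms\<close> unfolding paired_def by blast+
  have c0: "c > 0" using c(2) p0 by (cases c) simp_all
  have d: "d > 0" "partner d = c" "d \<noteq> c" "d < w"
    using partner_facts[OF c0] c(1) \<open>odd w\<close> by (auto simp: d_def)
  have hd: "col_height ms d = 0" using c(2) pr[OF c0] by (simp add: d_def)
  have inj: "partner x = c \<longleftrightarrow> x = d" "partner x = d \<longleftrightarrow> x = c" if "x > 0" for x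
    using partner_facts(2)[OF that] d(2) unfolding d_def by metis+
  show "legal w 1 (ms @ [c]) d"
    using d hd by (simp add: legal_def col_height_snoc)
  have other: "\<not> occupies ms p c r" "\<not> occupies ms p d r" for p r
    using c(2) hd by (auto simp: occupies_def)
  have cd: "ms @ [c, d] = (ms @ [c]) @ [d]" by simp
  have occ: "occupies (ms @ [c]) P1 x r \<longleftrightarrow> occupies ms P1 x r" for x r
    using \<open>odd (length ms)\<close> by (simp add: occupies_snoc mover_def)
  have occ': "occupies (ms @ [c, d]) P1 x 0 \<longleftrightarrow> occupies ms P1 x 0 \<or> x = d" for x
    using \<open>odd (length ms)\<close> d(3) hd
    unfolding cd occupies_snoc[of "ms @ [c]"] occ by (simp add: col_height_snoc mover_def)
  show "pairs_split (ms @ [c])"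
    using \<open>pairs_split ms\<close> by (simp add: pairs_split_def occ)
  show "pairs_split (ms @ [c, d])"
    unfolding pairs_split_def
  proof (intro allI impI)
    fix x :: nat assume "x > 0"
    then have "\<not> (occupies ms P1 x 0 \<and> occupies ms P1 (partner x) 0)"
      using \<open>pairs_split ms\<close> by (simp add: pairs_split_def)
    then show "\<not> (occupies (ms @ [c, d]) P1 x 0 \<and> occupies (ms @ [c, d]) P1 (partner x) 0)"
      using \<open>x > 0\<close> inj other d(3) unfolding occ' by metis
  qed
  have ht: "col_height (ms @ [c, d]) x = col_height ms x + (if x = c \<or> x = d then 1 else 0)" for x
    using d(3) unfolding cd col_height_snoc by simp
  show "paired (ms @ [c, d])"
    unfolding paired_def
  proof (intro conjI allI impI)
    show "col_height (ms @ [c, d]) 0 = 1" using p0 c0 d(1) by (simp add: ht)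
    fix x :: nat assume "x > 0"
    then show "col_height (ms @ [c, d]) x = col_height (ms @ [c, d]) (partner x)"
      using inj[of x] pr[of x] unfolding ht by simp
  qed
qed

text \<open>Partners have equal heights only after the first player's moves. For the positions in between the
  invariant therefore looks back by one move; this is also what makes the next answer
  available.\<close>

lemma pairing_invariant:
  assumes "play w 1 k ms" and "follows P1 pairing ms" and "odd w"
  shows "pairs_split ms \<and>
    (if odd (length ms) then paired ms
     else ms = [] \<or> (\<exists>ms' c. ms = ms' @ [c] \<and> paired ms' \<and> pairs_split ms' \<and> legal w 1 ms' c))"
  using assms(1,2)
proof (induction rule: play.induct)
  case start
  show ?case by (simp add: pairs_split_def occupies_def)
next
  case (move ms d)
  note IH = move.IH
  show ?case
  proof (cases "odd (length ms)")
    case True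
    then have "paired ms" "pairs_split ms" using move by (auto simp: follows_snoc)
    moreover from this have "pairs_split (ms @ [d])"
      using pairing_answer(2)[OF \<open>odd w\<close>] True move.hyps(3) by blast
    ultimately show ?thesis
      using True move.hyps(3) by simp
  next
    case False
    have d: "d = pairing ms" using False move.prems by (simp add: follows_snoc)
    show ?thesis
    proof (cases "ms = []")
      case True
      have ne: "partner c = 0 \<longleftrightarrow> c = 0" for c
        using partner_facts(1)[of c] by (cases "c = 0") (simp_all add: partner_def)
      have ht: "col_height [0] c = (if c = 0 then 1 else 0)" for c
        using col_height_snoc[of "[]" 0 c] by simp
      have "paired [0]" using ne by (simp add: paired_def ht)
      moreover have "pairs_split [0]" by (simp add: pairs_split_def occupies_def ht)
      ultimately show ?thesis using True d by (simp add: pairing_def)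
    next
      case nonempty: False
      then obtain ms' c where ms': "ms = ms' @ [c]" "paired ms'" "pairs_split ms'" "legal w 1 ms' c"
        using move.IH move.prems False by (auto simp: follows_snoc)
      then have odd': "odd (length ms')" and d': "d = partner c"
        using False d by (simp_all add: pairing_def)
      have "paired (ms @ [d])" "pairs_split (ms @ [d])"
        using pairing_answer(3,4)[OF \<open>odd w\<close> ms'(2,3) odd' ms'(4)] ms'(1) d' by simp_all
      then show ?thesis using False by simp
    qed
  qed
qed

lemma nonlosing_row_strategy_pairing:
  assumes "odd w" and "k \<ge> 3"
  shows "nonlosing_row_strategy w k pairing"
  unfolding nonlosing_row_strategy_def legal_strategy_def
proof (intro conjI allI impI)
  fix ms assume ms: "play w 1 k ms \<and> follows P1 pairing ms \<and> mover (length ms) = P1 \<and> \<not> game_over w 1 k ms"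
  show "legal w 1 ms (pairing ms)"
  proof (cases "ms = []")
    case True
    then show ?thesis using \<open>odd w\<close> by (auto simp: legal_def pairing_def intro: odd_pos)
  next
    case False
    then obtain ms' c where ms': "ms = ms' @ [c]" "paired ms'" "pairs_split ms'" "legal w 1 ms' c"
      using pairing_invariant[of w k ms] ms \<open>odd w\<close> by auto
    then have "odd (length ms')" using ms by simp
    then show ?thesis using pairing_answer(1)[OF \<open>odd w\<close> ms'(2,3) _ ms'(4)] ms'(1)
      by (simp add: pairing_def)
  qed
next
  fix ms assume ms: "play w 1 k ms \<and> follows P1 pairing ms"
  show "\<not> connects k P1 ms"
  proof
    assume conn: "connects k P1 ms"
    have le: "col_height ms c \<le> 1" for c using play_col_height_le ms by blast
    have "k \<ge> 2" using \<open>k \<ge> 3\<close> by simp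
    with conn show False
    proof (cases rule: connects_cases)
      case (row c r)
      have occ: "occupies ms P1 c r" "occupies ms P1 (c + 1) r" "occupies ms P1 (c + 2) r"
        using row[of 0] row[of 1] row[of 2] \<open>k \<ge> 3\<close> by auto
      have r: "r = 0" using occ(1) le[of c] by (simp add: occupies_def)
      \<comment> \<open>The left cell of the pair contained in three consecutive columns.\<close>
      define b where "b = (if odd c then c else c + 1)"
      have "b > 0" "occupies ms P1 b 0" "occupies ms P1 (partner b) 0"
        using occ r by (auto simp: b_def partner_def intro: odd_pos)
      then show False using pairing_invariant[of w k ms] ms \<open>odd w\<close>
        by (auto simp: pairs_split_def)
    next
      case (rising c d r)
      then show False using le[of d] by (simp add: occupies_def)
    qed
  qed
qed

section \<open>Striped boards and the moves in row 0\<close>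

text \<open>The stripes: for \<open>r > 0\<close> the owner of row \<open>r\<close> is \<open>mover r\<close>, that is, P1 for even \<open>r\<close> and
  P2 for odd \<open>r\<close>. Here \<open>mover\<close> is applied to a row number and serves merely as the parity
  function.\<close>

definition layered :: "history \<Rightarrow> bool" where
  "layered ms \<longleftrightarrow> (\<forall>c r. 0 < r \<and> r < col_height ms c \<longrightarrow> stack ms c ! r = mover r)"

lemma layered_occupies: "layered ms \<Longrightarrow> occupies ms p c r \<Longrightarrow> 0 < r \<Longrightarrow> mover r = p"
  by (auto simp: layered_def occupies_def)

lemma layered_snoc:
  assumes "layered ms"
    and "col_height ms c > 0 \<Longrightarrow> mover (length ms) = mover (col_height ms c)"
  shows "layered (ms @ [c])"
  unfolding layered_def
proof (intro allI impI)
  fix d r assume r: "0 < r \<and> r < col_height (ms @ [c]) d"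
  show "stack (ms @ [c]) d ! r = mover r"
  proof (cases "r < col_height ms d")
    case True
    then show ?thesis using r assms(1) by (auto simp: layered_def stack_snoc nth_append col_height_def)
  next
    case False
    then have "d = c" "r = col_height ms c" using r by (auto simp: col_height_snoc split: if_splits)
    then show ?thesis using r assms(2) by (simp add: stack_snoc nth_append col_height_def)
  qed
qed

text \<open>The owners in \<open>row0 ms\<close> are recomputed from positions in the shorter history. They
  agree with the true owners only if the players alternate in row 0, which is a property
  of the strategy.\<close>

definition row0_faithful :: "history \<Rightarrow> bool" where
  "row0_faithful ms \<longleftrightarrow> (\<forall>c. stack (row0 ms) c = take 1 (stack ms c))"

text \<open>A piece in row 0 keeps the right owner if the numbers of moves in row 0 and of all moves have the
  same parity.\<close>

lemma row0_faithful_snoc: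
  assumes "row0_faithful ms"
    and "col_height ms c = 0 \<Longrightarrow> mover (length (row0 ms)) = mover (length ms)"
  shows "row0_faithful (ms @ [c])"
  unfolding row0_faithful_def
proof
  fix d
  have "stack (row0 ms) d = take 1 (stack ms d)"
    using assms(1) by (simp add: row0_faithful_def)
  then show "stack (row0 (ms @ [c])) d = take 1 (stack (ms @ [c]) d)"
    using assms(2) by (cases "stack ms d") (auto simp: row0_snoc stack_snoc col_height_def)
qed

lemma col_height_row0: "row0_faithful ms \<Longrightarrow> col_height (row0 ms) c = min 1 (col_height ms c)"
  by (simp add: row0_faithful_def col_height_def)

lemma occupies_row0: "row0_faithful ms \<Longrightarrow> occupies (row0 ms) p c r \<longleftrightarrow> r = 0 \<and> occupies ms p c 0"
  by (auto simp: occupies_def col_height_row0 row0_faithful_def) 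

lemma connects_row0: "row0_faithful ms \<Longrightarrow> connects k p (row0 ms) \<Longrightarrow> connects k p ms"
  by (erule connects_mono) (simp add: occupies_row0)

text \<open>On a striped board a line of the first player is horizontal and in an even row. Unless this is
  row 0, the cells below it lie in an odd row and form a line of the second player.\<close>

lemma layered_P1_connects:
  assumes "connects k P1 ms" and "k \<ge> 2" and "layered ms" and "row0_faithful ms"
  shows "connects k P1 (row0 ms) \<or> connects k P2 ms"
  using assms(1,2)
proof (cases rule: connects_cases)
  case (row c r)
  show ?thesis
  proof (cases "r = 0")
    case True
    then show ?thesis using row \<open>row0_faithful ms\<close>
      by (intro disjI1 connects_rowI[where c = c and r = 0]) (simp add: occupies_row0)
  next
    case False
    have "occupies ms P1 c r" using row[of 0] \<open>k \<ge> 2\<close> by simp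
    then have "even r" using layered_occupies[OF \<open>layered ms\<close>, of P1 c r] False by simp
    then obtain q where q: "r = Suc q" "odd q" using False by (cases r) auto
    have "occupies ms P2 (c + i) q" if "i < k" for i
    proof -
      have "q < col_height ms (c + i)" using row[OF that] q by (simp add: occupies_def)
      then show ?thesis using \<open>layered ms\<close> q odd_pos[OF q(2)] by (simp add: layered_def occupies_def)
    qed
    then show ?thesis using connects_rowI by blast
  qed
next
  case (rising c d r)
  have "even (Suc r)" using layered_occupies[OF \<open>layered ms\<close> rising(2)] by simp
  moreover from this have "r > 0" by (auto intro: odd_pos)
  ultimately show ?thesis using layered_occupies[OF \<open>layered ms\<close> rising(1)]
    by simp
qed

section \<open>Play under delayed take-even\<close>

text \<open>The state of the board when the first player has just moved.\<close>

definition settled :: "history \<Rightarrow> bool" where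
  "settled ms \<longleftrightarrow> odd (length (row0 ms)) \<and> (\<forall>c. col_height ms c = 0 \<or> odd (col_height ms c))"

lemma settled_odd: "settled ms \<Longrightarrow> col_height ms c > 0 \<Longrightarrow> odd (col_height ms c)"
  by (metis settled_def less_numeral_extra(3))

text \<open>With the second player to move the position is settled. With the first player to move it is the
  initial position or arises by one move from a settled position: the reply depends on where the last
  piece landed, and the parity of that row is known only from the position before it.\<close>

definition take_even_position :: "nat \<Rightarrow> nat \<Rightarrow> strategy \<Rightarrow> history \<Rightarrow> bool" where
  "take_even_position w k \<sigma> ms \<longleftrightarrow>
     layered ms \<and> row0_faithful ms \<and>
     play w 1 k (row0 ms) \<and> follows P1 \<sigma> (row0 ms) \<and> \<not> connects k P1 ms \<and>
     (if odd (length ms) then settled ms else ms = [] \<or> (\<exists>ms' c. ms = ms' @ [c] \<and> settled ms'))"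

text \<open>The two parity arguments: a reply in row 0 exists since \<open>w\<close> is odd, and there is room for a reply
  on top of an odd row since \<open>h\<close> is odd.\<close>

lemma take_even_available:
  assumes pos: "take_even_position w k \<sigma> ms" and "play w h k ms"
    and over: "\<not> game_over w h k ms" and even: "even (length ms)"
    and \<sigma>: "nonlosing_row_strategy w k \<sigma>" and "odd h" and "odd w" and "k > 0"
  shows "available w h ms (take_even_cell \<sigma> ms)"
proof -
  have faithful: "row0_faithful ms" using pos by (simp add: take_even_position_def)
  have row: "col_height ms (\<sigma> (row0 ms)) = 0 \<and> \<sigma> (row0 ms) < w" if "even (length (row0 ms))"
  proof -
    have play: "play w 1 k (row0 ms)" and fol: "follows P1 \<sigma> (row0 ms)"
      using pos by (auto simp: take_even_position_def)
    have "\<exists>c. legal w 1 (row0 ms) c"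
    proof (rule ccontr)
      assume "\<nexists>c. legal w 1 (row0 ms) c"
      then have "col_height (row0 ms) c = 1" if "c < w" for c
        using that play_col_height_le[OF play, of c] by (force simp: legal_def)
      then have "length (row0 ms) = w" using play_length_eq_sum[OF play] by simp
      then show False using that \<open>odd w\<close> by simp
    qed
    then have "\<not> game_over w 1 k (row0 ms)"
      using over connects_row0[OF faithful] by (auto simp: game_over_def)
    then have "legal w 1 (row0 ms) (\<sigma> (row0 ms))"
      using \<sigma> play fol that by (simp add: nonlosing_row_strategy_def legal_strategy_def)
    then show ?thesis using col_height_row0[OF faithful] by (simp add: legal_def min_def split: if_splits)
  qed
  have h: "h > 0" using \<open>odd h\<close> by (rule odd_pos)
  show ?thesis
  proof (cases "ms = []")
    case True
    then show ?thesis using row h by (simp add: available_def legal_def take_even_cell_def)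
  next
    case False
    then obtain ms' c where ms: "ms = ms' @ [c]" and set: "settled ms'"
      using pos even by (auto simp: take_even_position_def)
    show ?thesis
    proof (cases "col_height ms' c = 0")
      case True
      then have "even (length (row0 ms))" using set ms by (simp add: settled_def row0_snoc)
      then show ?thesis using row h True
        by (simp add: available_def legal_def ms take_even_cell_snoc)
    next
      case False
      have "c < w" using \<open>play w h k ms\<close> unfolding ms
        by (cases rule: play.cases) (auto simp: legal_def)
      moreover have "even (col_height ms c)"
        using False settled_odd[OF set, of c] by (simp add: ms col_height_snoc)
      moreover have "col_height ms c \<le> h" using play_col_height_le \<open>play w h k ms\<close> by blast
      ultimately have "legal w h ms c" using \<open>odd h\<close> by (auto simp: legal_def le_less)
      then show ?thesis using False by (simp add: available_def ms take_even_cell_snoc col_height_snoc)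
    qed
  qed
qed

text \<open>A move of the second player from a settled position lands in row 0 or in an odd row, which
  preserves the stripes. The reply then lands in row 0 or in the even row above it,
  which restores the settled state.\<close>

lemma take_even_invariant:
  assumes "play w h k ms" and "follows P1 (delayed_take_even \<sigma>) ms"
    and \<sigma>: "nonlosing_row_strategy w k \<sigma>" and "odd h" and "odd w" and "k \<ge> 2"
  shows "take_even_position w k \<sigma> ms"
  using assms(1,2)
proof (induction rule: play.induct)
  case start
  have "\<not> connects k P1 []" using \<open>k \<ge> 2\<close>
    by (auto simp: connects_def occupies_def intro: exI[of _ 0])
  then show ?case
    by (simp add: take_even_position_def layered_def row0_faithful_def play.start)
next
  case (move ms c)
  have follows: "follows P1 (delayed_take_even \<sigma>) ms" using move.prems by (simp add: follows_snoc)
  then have pos: "take_even_position w k \<sigma> ms" by (rule move.IH)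
  then have layered: "layered ms" and faithful: "row0_faithful ms"
    and row_play: "play w 1 k (row0 ms)" and row_fol: "follows P1 \<sigma> (row0 ms)"
    by (auto simp: take_even_position_def)
  have row_play': "play w 1 k (row0 (ms @ [c]))"
  proof (cases "col_height ms c = 0")
    case True
    then have "legal w 1 (row0 ms) c"
      using move.hyps(3) col_height_row0[OF faithful] by (simp add: legal_def)
    moreover from this have "\<not> game_over w 1 k (row0 ms)"
      using move.hyps(2) connects_row0[OF faithful] by (auto simp: game_over_def)
    ultimately show ?thesis using True row_play by (simp add: row0_snoc play.move)
  qed (use row_play in \<open>simp add: row0_snoc\<close>)
  show ?case
  proof (cases "odd (length ms)")
    case True
    then have set: "settled ms" using pos by (simp add: take_even_position_def)
    have "layered (ms @ [c])"
      using layered by (rule layered_snoc) (use settled_odd[OF set, of c] True in \<open>auto simp: settled_def mover_def\<close>)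
    moreover have "row0_faithful (ms @ [c])"
      using faithful by (rule row0_faithful_snoc) (use set True in \<open>auto simp: settled_def mover_def\<close>)
    moreover have "follows P1 \<sigma> (row0 (ms @ [c]))"
      using row_fol set by (simp add: row0_snoc follows_snoc settled_def)
    moreover have "\<not> connects k P1 (ms @ [c])"
      using connects_snoc_other[of k P1 ms c] True pos by (auto simp: take_even_position_def)
    ultimately show ?thesis using row_play' set True by (simp add: take_even_position_def)
  next
    case False
    then have even: "even (length ms)" by simp
    have c: "c = fst (take_even_cell \<sigma> ms)"
      using move.prems even by (simp add: follows_snoc delayed_take_even_def)
    have avail: "available w h ms (take_even_cell \<sigma> ms)"
      using take_even_available[OF pos move.hyps(1,2) even \<sigma> \<open>odd h\<close> \<open>odd w\<close>] \<open>k \<ge> 2\<close> by simp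
    \<comment> \<open>Where the reply lands, in the form that the stripes and the alternation in row 0 require.\<close>
    have step: "(col_height ms c = 0 \<longrightarrow> even (length (row0 ms)) \<and> c = \<sigma> (row0 ms)) \<and>
        (col_height ms c > 0 \<longrightarrow> even (col_height ms c)) \<and> settled (ms @ [c])"
    proof (cases "ms = []")
      case True
      then show ?thesis using c col_height_snoc[of "[]"] row0_snoc[of "[]"]
        by (auto simp: take_even_cell_def settled_def)
    next
      case False
      then obtain ms' b where ms: "ms = ms' @ [b]" and set: "settled ms'"
        using pos even by (auto simp: take_even_position_def)
      have snd: "col_height ms c = snd (take_even_cell \<sigma> ms)"
        using avail c by (simp add: available_def)
      show ?thesis
      proof (cases "col_height ms' b = 0")
        case True
        then have "col_height ms c = 0" "c = \<sigma> (row0 ms)"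
          using c snd by (auto simp: ms take_even_cell_snoc)
        moreover have "even (length (row0 ms))" using True set by (simp add: ms row0_snoc settled_def)
        moreover have "settled (ms @ [c])"
          using set True \<open>col_height ms c = 0\<close> \<open>even (length (row0 ms))\<close>
            row0_snoc[of ms c] col_height_snoc[of ms c]
          by (auto simp: settled_def ms col_height_snoc split: if_splits)
        ultimately show ?thesis by simp
      next
        case False
        then have "c = b" "col_height ms c = col_height ms' b + 1"
          using c snd by (auto simp: ms take_even_cell_snoc)
        then show ?thesis using False set settled_odd[OF set, of b] row0_snoc[of ms c] col_height_snoc[of ms c]
          by (auto simp: settled_def ms col_height_snoc row0_snoc)
      qed
    qed
    have layered': "layered (ms @ [c])"
      using layered by (rule layered_snoc) (use step even in \<open>auto simp: mover_def\<close>)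
    have faithful': "row0_faithful (ms @ [c])"
      using faithful by (rule row0_faithful_snoc) (use step even in \<open>auto simp: mover_def\<close>)
    have row_fol': "follows P1 \<sigma> (row0 (ms @ [c]))"
      using row_fol step by (simp add: row0_snoc follows_snoc)
    have "\<not> connects k P1 (row0 (ms @ [c]))"
      using \<sigma> row_play' row_fol' by (simp add: nonlosing_row_strategy_def)
    moreover have "\<not> connects k P2 (ms @ [c])"
      using connects_snoc_other[of k P2 ms c] even move.hyps(2) by (auto simp: game_over_def)
    \<comment> \<open>The reply adds no piece of P2, so a line of P2 below one of P1 would have ended the game earlier.\<close>
    ultimately have "\<not> connects k P1 (ms @ [c])"
      using layered_P1_connects[OF _ \<open>k \<ge> 2\<close> layered' faithful'] by blast
    then show ?thesis using layered' faithful' row_play' row_fol' step even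
      by (simp add: take_even_position_def)
  qed
qed

lemma full_layered_P2_connects:
  assumes "layered ms" and full: "\<forall>c. \<not> legal w h ms c" and "h \<ge> 2" and "w \<ge> k"
  shows "connects k P2 ms"
proof (rule connects_rowI[where c = 0 and r = 1])
  fix i assume "i < k"
  then have "1 < col_height ms i" using full[rule_format, of i] \<open>h \<ge> 2\<close> \<open>w \<ge> k\<close> by (simp add: legal_def)
  then show "occupies ms P2 (0 + i) 1"
    using \<open>layered ms\<close> by (simp add: layered_def occupies_def)
qed

theorem corollary2:
  fixes w h k :: nat
  assumes "odd h" and "h \<ge> 3" and "odd w" and "w \<ge> k" and "k \<ge> 3"
  shows
    "(\<exists>\<sigma>. nonlosing_row_strategy w k \<sigma>) \<and>
     (\<forall>\<sigma>. nonlosing_row_strategy w k \<sigma> \<longrightarrow>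
        (\<forall>ms. play w h k ms \<and> follows P1 (delayed_take_even \<sigma>) ms \<longrightarrow>
           \<not> connects k P1 ms \<and>
           (mover (length ms) = P1 \<and> \<not> game_over w h k ms \<longrightarrow>
              available w h ms (take_even_cell \<sigma> ms))) \<and>
        (\<forall>t. legal_strategy w h k P2 t \<longrightarrow>
           (\<exists>ms. play w h k ms \<and> follows P1 (delayed_take_even \<sigma>) ms \<and> follows P2 t ms \<and>
                 connects k P2 ms \<and> \<not> connects k P1 ms))) \<and>
     (\<exists>s. winning_strategy w h k P1 s)"
proof -
  have row: "nonlosing_row_strategy w k pairing"
    using \<open>odd w\<close> \<open>k \<ge> 3\<close> by (rule nonlosing_row_strategy_pairing)
  have inv: "take_even_position w k \<sigma> ms"
    if "nonlosing_row_strategy w k \<sigma>" "play w h k ms" "follows P1 (delayed_take_even \<sigma>) ms" for \<sigma> ms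
    using take_even_invariant[OF that(2,3,1)] assms by simp
  have safe: "\<not> connects k P1 ms"
    if "nonlosing_row_strategy w k \<sigma>" "play w h k ms" "follows P1 (delayed_take_even \<sigma>) ms" for \<sigma> ms
    using inv[OF that] by (simp add: take_even_position_def)
  have avail: "available w h ms (take_even_cell \<sigma> ms)"
    if "nonlosing_row_strategy w k \<sigma>" "play w h k ms" "follows P1 (delayed_take_even \<sigma>) ms"
      "mover (length ms) = P1" "\<not> game_over w h k ms" for \<sigma> ms
    using take_even_available[OF inv[OF that(1-3)] that(2,5) _ that(1)] that(4) assms by simp
  have legal: "legal_strategy w h k P1 (delayed_take_even \<sigma>)"
    if "nonlosing_row_strategy w k \<sigma>" for \<sigma>
    using avail[OF that] by (auto simp: legal_strategy_def delayed_take_even_def available_def)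
  have win: "\<exists>ms. play w h k ms \<and> follows P1 (delayed_take_even \<sigma>) ms \<and> follows P2 t ms \<and>
      connects k P2 ms \<and> \<not> connects k P1 ms"
    if \<sigma>: "nonlosing_row_strategy w k \<sigma>" and t: "legal_strategy w h k P2 t" for \<sigma> t
  proof -
    obtain ms where ms: "play w h k ms" "follows P1 (delayed_take_even \<sigma>) ms" "follows P2 t ms"
      and over: "game_over w h k ms"
      using ex_complete_play[OF legal[OF \<sigma>] t] by blast
    have "layered ms" using inv[OF \<sigma> ms(1,2)] by (simp add: take_even_position_def)
    then have "connects k P2 ms"
      using full_layered_P2_connects[of ms w h k] over safe[OF \<sigma> ms(1,2)] assms
      by (auto simp: game_over_def)
    then show ?thesis using ms safe[OF \<sigma> ms(1,2)] by blast
  qed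
  have "winning_strategy w h k P1 (delayed_take_even pairing)"
    using legal[OF row] win[OF row] by (simp add: winning_strategy_def wins_def) blast
  then show ?thesis using row safe avail win by blast
qed

end
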